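(* Let $(V,d)$ be a bounded closed Hilbert complex, $(V_h,d)$ a Hilbert subcomplex, and $\pi_h$ a bounded cochain projection from $(V,d)$ to $(V_h,d)$. Then for each $k$ $$\|(I-P_{\mathfrak H_h})q\|_V\le\|(I-\pi_h^k)q\|_V,\qquad q\in\mathfrak H^k,$$ $$\|(I-P_{\mathfrak H})q\|_V\le\|(I-\pi_h^k)P_{\mathfrak H}q\|_V,\qquad q\in\mathfrak H_h^k,$$ $$\operatorname{gap}(\mathfrak H^k,\mathfrak H_h^k)\le\sup_{q\in\mathfrak H^k,\ \|q\|_V=1}\|(I-\pi_h^k)q\|_V.$$
   Context: A bounded closed Hilbert complex $(V,d)$ is a finite sequence of real Hilbert spaces $V^k$ and bounded linear operators $d^k:V^k\to V^{k+1}$ with $d^{k+1}\circ d^k=0$ and with the range of each $d^k$ closed. $\mathfrak Z^k=\ker d^k$, $\mathfrak B^k=d^{k-1}V^{k-1}$, and $\mathfrak H^k=\mathfrak Z^k\cap(\mathfrak B^k)^\perp$. A Hilbert subcomplex $(V_h,d)$ consists of finite-dimensional subspaces $V_h^k\subset V^k$ with $d^kV_h^k\subset V_h^{k+1}$, with inherited inner product and differential; $\mathfrak Z_h^k=\ker(d^k|_{V_h^k})$, $\mathfrak B_h^k=d^{k-1}V_h^{k-1}$, $\mathfrak H_h^k=\mathfrak Z_h^k\cap(\mathfrak B_h^k)^\perp$. $P_{\mathfrak H}$ and $P_{\mathfrak H_h}$ are the orthogonal projections of $V^k$ onto $\mathfrak H^k$ and $\mathfrak H_h^k$. A bounded cochain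 projection $\pi_h$ is a collection of bounded linear maps $\pi_h^k:V^k\to V_h^k$ which restrict to the identity on $V_h^k$ and satisfy $d^k\pi_h^k=\pi_h^{k+1}d^k$. For subspaces $E,F$ of a Hilbert space $V$, $$\operatorname{gap}(E,F)=\max\Bigl(\sup_{u\in E,\|u\|_V=1}\inf_{v\in F}\|u-v\|_V,\ \sup_{v\in F,\|v\|_V=1}\inf_{u\in E}\|u-v\|_V\Bigr),$$ with a supremum over an empty set read as $0$. *)

theory Defs
  imports "HOL-Analysis.Analysis"
begin

definition bounded_linear_from_to ::
  "'a::real_normed_vector set \<Rightarrow> 'b::real_normed_vector set \<Rightarrow> ('a \<Rightarrow> 'b) \<Rightarrow> bool" where
  "bounded_linear_from_to S T f \<longleftrightarrow>
     f ` S \<subseteq> T \<and>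
     (\<forall>x\<in>S. \<forall>y\<in>S. f (x + y) = f x + f y) \<and>
     (\<forall>c. \<forall>x\<in>S. f (c *\<^sub>R x) = c *\<^sub>R f x) \<and>
     (\<exists>K. \<forall>x\<in>S. norm (f x) \<le> K * norm x)"

text \<open>
  The spaces of a complex are complete subspaces of one real inner product type, so that the
  degree can be an ordinary variable. This is no restriction: a finite sequence of Hilbert spaces
  embeds isometrically in its direct sum. Nothing is assumed about the relative position of the
  spaces. Only the values of the operators on their spaces matter. A finite sequence is
  indexed by all integers, with the zero space outside a finite range of degrees; thus the
  differentials into the first space and out of the last one are zero. Since every space is
  complete, the ambient closedness of a range agrees with closedness in its target space.
\<close>

locale bounded_closed_hilbert_complex =
  fixes V :: "int \<Rightarrow> 'a::real_inner set" and d :: "int \<Rightarrow> 'a \<Rightarrow> 'a"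
  assumes finite_sequence: "finite {k. V k \<noteq> {0}}"
    and subspace_V: "subspace (V k)"
    and complete_V: "complete (V k)"
    and bounded_linear_d: "bounded_linear_from_to (V k) (V (k + 1)) (d k)"
    and d_d: "v \<in> V k \<Longrightarrow> d (k + 1) (d k v) = 0"
    and closed_range: "closed (d k ` V k)"

locale hilbert_subcomplex = bounded_closed_hilbert_complex V d
  for V :: "int \<Rightarrow> 'a::real_inner set" and d :: "int \<Rightarrow> 'a \<Rightarrow> 'a" +
  fixes V\<^sub>h :: "int \<Rightarrow> 'a set"
  assumes finite_dimensional: "\<exists>B. finite B \<and> span B = V\<^sub>h k"
    and subset_V: "V\<^sub>h k \<subseteq> V k"
    and d_maps: "d k ` V\<^sub>h k \<subseteq> V\<^sub>h (k + 1)"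

locale bounded_cochain_projection = hilbert_subcomplex V d V\<^sub>h
  for V :: "int \<Rightarrow> 'a::real_inner set" and d :: "int \<Rightarrow> 'a \<Rightarrow> 'a" and V\<^sub>h :: "int \<Rightarrow> 'a set" +
  fixes \<pi>\<^sub>h :: "int \<Rightarrow> 'a \<Rightarrow> 'a"
  assumes bounded_linear_\<pi>: "bounded_linear_from_to (V k) (V\<^sub>h k) (\<pi>\<^sub>h k)"
    and projection: "v \<in> V\<^sub>h k \<Longrightarrow> \<pi>\<^sub>h k v = v"
    and cochain: "v \<in> V k \<Longrightarrow> d k (\<pi>\<^sub>h k v) = \<pi>\<^sub>h (k + 1) (d k v)"

text \<open>
  The following are used both for a complex and for a subcomplex, which has the same
  differentials and inner product.
\<close>

definition cycles ::
  "(int \<Rightarrow> 'a::real_inner set) \<Rightarrow> (int \<Rightarrow> 'a \<Rightarrow> 'a) \<Rightarrow> int \<Rightarrow> 'a set" where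
  "cycles V d k = {v \<in> V k. d k v = 0}"

definition boundaries ::
  "(int \<Rightarrow> 'a::real_inner set) \<Rightarrow> (int \<Rightarrow> 'a \<Rightarrow> 'a) \<Rightarrow> int \<Rightarrow> 'a set" where
  "boundaries V d k = d (k - 1) ` V (k - 1)"

definition harmonics ::
  "(int \<Rightarrow> 'a::real_inner set) \<Rightarrow> (int \<Rightarrow> 'a \<Rightarrow> 'a) \<Rightarrow> int \<Rightarrow> 'a set" where
  "harmonics V d k = cycles V d k \<inter> (boundaries V d k)\<^sup>\<bottom>"

text \<open>
  The point described here exists and is unique whenever \<open>S\<close> is a complete subspace.
\<close>

definition orthogonal_projection :: "'a::real_inner set \<Rightarrow> 'a \<Rightarrow> 'a" where
  "orthogonal_projection S x = (THE y. y \<in> S \<and> x - y \<in> S\<^sup>\<bottom>)"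

text \<open>
  \<open>Sup {}\<close> is unspecified on the reals; here the supremum of the empty set is \<open>0\<close>.
\<close>

definition Sup_or_zero :: "real set \<Rightarrow> real" where
  "Sup_or_zero A = (if A = {} then 0 else Sup A)"

definition gap :: "'a::real_inner set \<Rightarrow> 'a set \<Rightarrow> real" where
  "gap E F = max (Sup_or_zero {INF v\<in>F. norm (u - v) | u. u \<in> E \<and> norm u = 1})
                 (Sup_or_zero {INF u\<in>E. norm (u - v) | v. v \<in> F \<and> norm v = 1})"

end

(*
  For q in H the projection of q onto the discrete cycles stays orthogonal to the discrete
  boundaries, so it is the projection onto H_h; the projection pi q is another discrete cycle,
  and the best approximation property gives the first bound. For q in H_h the error
  b = q - P q is a boundary, and pi b is a discrete boundary, orthogonal both to q and to P q.
  Hence (b, b) = (b, b - pi b), while pi q = q gives b - pi b = -(P q - pi P q); Cauchy-Schwarz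
  yields the second bound. The gap estimate follows from both by homogeneity and |P q| <= |q|.
*)

theory Submission
  imports Defs
begin

section \<open>Orthogonal projections in inner product spaces\<close>

lemma mem_orthogonal_comp_iff: "x \<in> S\<^sup>\<bottom> \<longleftrightarrow> (\<forall>y\<in>S. x \<bullet> y = 0)"
  by (auto simp: orthogonal_comp_def orthogonal_def inner_commute)

text \<open>Two candidates differ by an element of \<open>S\<close> that is orthogonal to
  \<open>S\<close>, hence to itself. This evaluates the definite description as soon as one
  candidate is exhibited; existence is proved separately.\<close>

lemma orthogonal_projection_eqI:
  assumes S: "subspace S" and y: "y \<in> S" "x - y \<in> S\<^sup>\<bottom>"
  shows "orthogonal_projection S x = y"
  unfolding orthogonal_projection_def
proof (rule the_equality)
  show "y \<in> S \<and> x - y \<in> S\<^sup>\<bottom>"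
    using y by blast
next
  fix z assume z: "z \<in> S \<and> x - z \<in> S\<^sup>\<bottom>"
  then have "z - y \<in> S"
    using S y by (simp add: subspace_diff)
  then have "(x - y) \<bullet> (z - y) = 0" "(x - z) \<bullet> (z - y) = 0"
    using y z by (auto simp: mem_orthogonal_comp_iff)
  then have "(z - y) \<bullet> (z - y) = 0"
    by (simp add: inner_diff_left)
  then show "z = y"
    by simp
qed

text \<open>Best approximation: split \<open>x - z\<close> into \<open>x - y\<close> and
  \<open>y - z\<close>, which are orthogonal, and drop one square from Pythagoras.\<close>

lemma norm_diff_le_of_orthogonal:
  assumes S: "subspace S" and "y \<in> S" "x - y \<in> S\<^sup>\<bottom>" "z \<in> S"
  shows "norm (x - y) \<le> norm (x - z)"
proof -
  have "y - z \<in> S"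
    using assms by (simp add: subspace_diff)
  then have "orthogonal (x - y) (y - z)"
    using assms by (auto simp: mem_orthogonal_comp_iff orthogonal_def)
  then have "(norm (x - y + (y - z)))\<^sup>2 = (norm (x - y))\<^sup>2 + (norm (y - z))\<^sup>2"
    by (rule norm_add_Pythagorean)
  then have "(norm (x - y))\<^sup>2 \<le> (norm (x - z))\<^sup>2"
    by simp
  then show ?thesis
    using power2_le_imp_le by auto
qed

lemma norm_le_of_orthogonal:
  assumes "y \<in> S" "x - y \<in> S\<^sup>\<bottom>"
  shows "norm y \<le> norm x"
proof -
  have "orthogonal (x - y) y"
    using assms by (auto simp: mem_orthogonal_comp_iff orthogonal_def)
  then have "(norm (x - y + y))\<^sup>2 = (norm (x - y))\<^sup>2 + (norm y)\<^sup>2"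
    by (rule norm_add_Pythagorean)
  then have "(norm y)\<^sup>2 \<le> (norm x)\<^sup>2"
    by simp
  then show ?thesis
    using power2_le_imp_le by auto
qed

text \<open>The classical minimizing sequence argument. The parallelogram law makes such a sequence
  Cauchy; its limit exists because \<open>S\<close> itself is complete, while the ambient type is
  only an inner product space.\<close>

lemma ex_orthogonal_projection_complete:
  fixes S :: "'a::real_inner set"
  assumes S: "subspace S" and "complete S"
  shows "\<exists>y\<in>S. x - y \<in> S\<^sup>\<bottom>"
proof -
  define D where "D = (INF s\<in>S. (norm (x - s))\<^sup>2)"
  have ne: "S \<noteq> {}"
    using subspace_0[OF S] by blast
  have bdd: "bdd_below ((\<lambda>s. (norm (x - s))\<^sup>2) ` S)"
    by (rule bdd_belowI2[where m = 0]) simp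
  have D_le: "D \<le> (norm (x - s))\<^sup>2" if "s \<in> S" for s
    unfolding D_def by (rule cINF_lower[OF bdd that])
  have "\<exists>s\<in>S. (norm (x - s))\<^sup>2 < D + inverse (real (Suc n))" for n
    using cINF_less_iff[OF ne bdd, of "D + inverse (real (Suc n))"] by (simp add: D_def)
  then obtain s where sS: "\<And>n. s n \<in> S"
    and s: "\<And>n. (norm (x - s n))\<^sup>2 < D + inverse (real (Suc n))"
    by metis
  have close: "(norm (s m - s n))\<^sup>2 \<le> 2 * inverse (real (Suc m)) + 2 * inverse (real (Suc n))" for m n
  proof -
    have "(1/2) *\<^sub>R (s m + s n) \<in> S"
      using S sS by (simp add: subspace_add subspace_scale)
    from D_le[OF this]
    have "4 * D \<le> 4 * (norm (x - (1/2) *\<^sub>R (s m + s n)))\<^sup>2"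
      by simp
    \<comment> \<open>Parallelogram law for \<open>x - s m\<close> and \<open>x - s n\<close>. The
      chain substitutes the previous inequality into the left summand, so it ends with
      \<open>4 * D\<close> plus the squared distance on the left.\<close>
    also have "\<dots> + (norm (s m - s n))\<^sup>2 = 2 * (norm (x - s m))\<^sup>2 + 2 * (norm (x - s n))\<^sup>2"
      by (simp add: power2_norm_eq_inner inner_add_left inner_add_right inner_diff_left
          inner_diff_right inner_commute algebra_simps)
    finally show ?thesis
      using s[of m] s[of n] by linarith
  qed
  have "Cauchy s"
  proof (rule metric_CauchyI)
    fix e :: real assume "e > 0"
    \<comment> \<open>Each of the two terms in \<open>close\<close> is then below half of the
      squared \<open>e\<close>.\<close>
    then obtain N where N: "inverse (real (Suc N)) < e\<^sup>2 / 4"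
      using reals_Archimedean[of "e\<^sup>2 / 4"] by auto
    have "dist (s m) (s n) < e" if "m \<ge> N" "n \<ge> N" for m n
    proof -
      have "inverse (real (Suc m)) \<le> inverse (real (Suc N))"
           "inverse (real (Suc n)) \<le> inverse (real (Suc N))"
        using that by (auto intro!: le_imp_inverse_le)
      with N close[of m n] have "(norm (s m - s n))\<^sup>2 < e\<^sup>2"
        by linarith
      then show ?thesis
        using \<open>e > 0\<close> by (simp add: dist_norm power2_less_imp_less)
    qed
    then show "\<exists>M. \<forall>m\<ge>M. \<forall>n\<ge>M. dist (s m) (s n) < e"
      by blast
  qed
  with \<open>complete S\<close> sS obtain y where y: "y \<in> S" "s \<longlonglongrightarrow> y"
    by (auto simp: complete_def)
  have "(\<lambda>n. (norm (x - s n))\<^sup>2) \<longlonglongrightarrow> (norm (x - y))\<^sup>2"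
    by (intro tendsto_intros y)
  moreover have "(\<lambda>n. D + inverse (real (Suc n))) \<longlonglongrightarrow> D + 0"
    by (intro tendsto_intros LIMSEQ_inverse_real_of_nat)
  ultimately have min: "(norm (x - y))\<^sup>2 \<le> D"
    using s by (auto intro: LIMSEQ_le less_imp_le)
  have "(x - y) \<bullet> z = 0" if "z \<in> S" for z
  proof (cases "z = 0")
    case False
    \<comment> \<open>This \<open>t\<close> minimizes the norm of
      \<open>(x - y) - t *\<^sub>R z\<close>. Since \<open>y\<close> is already a closest point, the
      gain, which is the square of \<open>(x - y) \<bullet> z\<close> divided by
      \<open>z \<bullet> z\<close>, cannot be positive.\<close>
    define t where "t = ((x - y) \<bullet> z) / (z \<bullet> z)"
    have "y + t *\<^sub>R z \<in> S"
      using S y that by (simp add: subspace_add subspace_scale)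
    with D_le min have "(norm (x - y))\<^sup>2 \<le> (norm ((x - y) - t *\<^sub>R z))\<^sup>2"
      by (metis diff_diff_eq order_trans)
    moreover have "(norm (w - t *\<^sub>R z))\<^sup>2 = (norm w)\<^sup>2 - 2 * t * (w \<bullet> z) + t * t * (z \<bullet> z)" for w
      by (simp add: power2_norm_eq_inner inner_diff_left inner_diff_right inner_commute
          algebra_simps)
    ultimately have "2 * t * ((x - y) \<bullet> z) \<le> t * t * (z \<bullet> z)"
      by simp
    also have "\<dots> = t * ((x - y) \<bullet> z)"
      using False by (simp add: t_def)
    finally have "t * ((x - y) \<bullet> z) \<le> 0"
      by simp
    then have "((x - y) \<bullet> z)\<^sup>2 / (z \<bullet> z) \<le> 0"
      by (simp add: t_def power2_eq_square)
    moreover have "0 < z \<bullet> z"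
      using False by simp
    ultimately show ?thesis
      by (simp add: divide_le_0_iff)
  qed simp
  with y show ?thesis
    by (auto simp: mem_orthogonal_comp_iff)
qed

text \<open>Gram-Schmidt gives \<open>S\<close> a finite orthogonal spanning set, and the projection
  is the corresponding Fourier sum. It serves for the discrete cycles.\<close>

lemma ex_orthogonal_projection_finite_dimensional:
  fixes S :: "'a::real_inner set"
  assumes S: "subspace S" and "finite B" "S \<subseteq> span B"
  shows "\<exists>y\<in>S. x - y \<in> S\<^sup>\<bottom>"
proof -
  obtain A where A: "A \<subseteq> S" "independent A" "S \<subseteq> span A"
    by (rule maximal_independent_subset)
  then have "finite A"
    using independent_span_bound[OF \<open>finite B\<close>] assms(3) by blast
  from basis_orthogonal[OF this] obtain C where
    C: "finite C" "span C = span A" "pairwise orthogonal C"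
    by blast
  have "span A = S"
    using A S span_minimal by blast
  with C have SC: "S = span C"
    by simp
  define y where "y = (\<Sum>c\<in>C. (c \<bullet> x / (c \<bullet> c)) *\<^sub>R c)"
  have "y \<in> S"
    unfolding y_def SC by (intro span_sum span_scale span_base)
  moreover have "orthogonal (x - y) c" if "c \<in> C" for c
  proof -
    have "y \<bullet> c = (\<Sum>b\<in>C. (b \<bullet> x / (b \<bullet> b)) * (b \<bullet> c))"
      by (simp add: y_def inner_sum_left)
    \<comment> \<open>The set \<open>C\<close> is not known to omit zero; in the case
      \<open>b = c = 0\<close> both sides vanish, as division by zero yields zero.\<close>
    also have "\<dots> = (\<Sum>b\<in>C. if b = c then x \<bullet> c else 0)"
      using C(3) that
      by (intro sum.cong) (auto simp: pairwise_def orthogonal_def inner_commute)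
    also have "\<dots> = x \<bullet> c"
      using C(1) that by simp
    finally show ?thesis
      by (simp add: orthogonal_def inner_diff_left)
  qed
  then have "x - y \<in> S\<^sup>\<bottom>"
    unfolding SC mem_orthogonal_comp_iff by (metis orthogonal_to_span orthogonal_def)
  ultimately show ?thesis
    by blast
qed

section \<open>Linear maps between subspaces\<close>

lemma bounded_linear_from_to_0:
  assumes "bounded_linear_from_to S T f" "subspace S"
  shows "f 0 = 0"
  using assms subspace_0[of S] unfolding bounded_linear_from_to_def
  by (metis scaleR_zero_left)

lemma bounded_linear_from_to_diff:
  assumes f: "bounded_linear_from_to S T f" and S: "subspace S" and "x \<in> S" "y \<in> S"
  shows "f (x - y) = f x - f y"
proof -
  have "f ((x - y) + y) = f (x - y) + f y"
    using assms subspace_diff[OF S] unfolding bounded_linear_from_to_def by blast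
  then show ?thesis
    by simp
qed

lemma subspace_image_from_to:
  assumes f: "bounded_linear_from_to S T f" and S: "subspace S"
  shows "subspace (f ` S)"
proof (rule subspaceI)
  show "0 \<in> f ` S"
    using bounded_linear_from_to_0[OF f S] subspace_0[OF S] by force
next
  fix u v assume "u \<in> f ` S" "v \<in> f ` S"
  then obtain x y where "x \<in> S" "y \<in> S" "u = f x" "v = f y"
    by blast
  then have "u + v = f (x + y)" "x + y \<in> S"
    using f S by (auto simp: bounded_linear_from_to_def subspace_add)
  then show "u + v \<in> f ` S"
    by blast
next
  fix c u assume "u \<in> f ` S"
  then obtain x where "x \<in> S" "u = f x"
    by blast
  then have "c *\<^sub>R u = f (c *\<^sub>R x)" "c *\<^sub>R x \<in> S"
    using f S by (auto simp: bounded_linear_from_to_def subspace_scale)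
  then show "c *\<^sub>R u \<in> f ` S"
    by blast
qed

lemma subspace_cycles:
  assumes f: "bounded_linear_from_to (V k) T (d k)" and S: "subspace (V k)"
  shows "subspace (cycles V d k)"
  using f S bounded_linear_from_to_0[OF f S]
  by (auto simp: cycles_def bounded_linear_from_to_def intro!: subspaceI
      dest: subspace_0 subspace_add subspace_scale)

lemma subspace_harmonics:
  assumes "bounded_linear_from_to (V k) T (d k)" "subspace (V k)"
  shows "subspace (harmonics V d k)"
  unfolding harmonics_def
  by (intro subspace_inter subspace_cycles[where V = V and d = d and k = k, OF assms]
      subspace_orthogonal_comp)

section \<open>Harmonic forms\<close>

context bounded_closed_hilbert_complex
begin

lemma subspace_cycles_V: "subspace (cycles V d k)"
  by (rule subspace_cycles[where V = V and d = d, OF bounded_linear_d subspace_V])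

lemma subspace_harmonics_V: "subspace (harmonics V d k)"
  by (rule subspace_harmonics[where V = V and d = d, OF bounded_linear_d subspace_V])

lemma harmonics_subset: "harmonics V d k \<subseteq> V k"
  by (auto simp: harmonics_def cycles_def)

lemma boundaries_subset_cycles: "boundaries V d k \<subseteq> cycles V d k"
  using bounded_linear_d[of "k - 1"] d_d[of _ "k - 1"]
  by (auto simp: boundaries_def cycles_def bounded_linear_from_to_def)

text \<open>The closed range hypothesis enters here: a closed subset of the complete space
  \<open>V k\<close> is complete, so there is an orthogonal projection onto the boundaries.\<close>

lemma complete_boundaries: "complete (boundaries V d k)"
  using boundaries_subset_cycles[of k] closed_range[of "k - 1"]
  by (intro complete_closed_subset[OF _ _ complete_V[of k]])
    (auto simp: boundaries_def cycles_def)

text \<open>The Hodge decomposition of cycles. One projects onto the boundaries instead of the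
  harmonics: the residual is a cycle orthogonal to the boundaries, hence harmonic, and the removed
  part is a boundary, orthogonal to all harmonics.\<close>

lemma cycle_harmonic_projection:
  assumes q: "q \<in> cycles V d k"
  defines "P \<equiv> orthogonal_projection (harmonics V d k)"
  shows "P q \<in> harmonics V d k" "q - P q \<in> (harmonics V d k)\<^sup>\<bottom>"
    and "q - P q \<in> boundaries V d k"
proof -
  have "subspace (boundaries V d k)"
    unfolding boundaries_def by (rule subspace_image_from_to[OF bounded_linear_d subspace_V])
  from ex_orthogonal_projection_complete[OF this complete_boundaries]
  obtain b where b: "b \<in> boundaries V d k" "q - b \<in> (boundaries V d k)\<^sup>\<bottom>"
    by blast
  have "b \<in> cycles V d k"
    using b boundaries_subset_cycles by blast
  then have h: "q - b \<in> harmonics V d k"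
    using q b subspace_diff[OF subspace_cycles_V]
    by (simp add: harmonics_def)
  moreover have b': "b \<in> (harmonics V d k)\<^sup>\<bottom>"
    using b by (auto simp: harmonics_def mem_orthogonal_comp_iff inner_commute)
  ultimately have "P q = q - b"
    unfolding P_def
    by (intro orthogonal_projection_eqI subspace_harmonics_V) simp_all
  then show "P q \<in> harmonics V d k" "q - P q \<in> (harmonics V d k)\<^sup>\<bottom>" "q - P q \<in> boundaries V d k"
    using h b b' by simp_all
qed

end

section \<open>Cycles, boundaries and harmonic forms of the subcomplex\<close>

context hilbert_subcomplex
begin

lemma subspace_V\<^sub>h: "subspace (V\<^sub>h k)"
  using finite_dimensional[of k] by (metis subspace_span)

lemma bounded_linear_d\<^sub>h: "bounded_linear_from_to (V\<^sub>h k) (V\<^sub>h (k + 1)) (d k)"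
  using bounded_linear_d[of k] subset_V[of k] d_maps[of k]
  unfolding bounded_linear_from_to_def by (meson subsetD)

lemma subspace_cycles_V\<^sub>h: "subspace (cycles V\<^sub>h d k)"
  by (rule subspace_cycles[where V = V\<^sub>h and d = d, OF bounded_linear_d\<^sub>h subspace_V\<^sub>h])

lemma subspace_harmonics_V\<^sub>h: "subspace (harmonics V\<^sub>h d k)"
  by (rule subspace_harmonics[where V = V\<^sub>h and d = d, OF bounded_linear_d\<^sub>h subspace_V\<^sub>h])

lemma cycles\<^sub>h_subset: "cycles V\<^sub>h d k \<subseteq> cycles V d k"
  using subset_V by (auto simp: cycles_def)

lemma boundaries\<^sub>h_subset: "boundaries V\<^sub>h d k \<subseteq> boundaries V d k"
  using subset_V by (auto simp: boundaries_def)

lemma boundaries\<^sub>h_subset_cycles\<^sub>h: "boundaries V\<^sub>h d k \<subseteq> cycles V\<^sub>h d k"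
  using boundaries\<^sub>h_subset[of k] boundaries_subset_cycles[of k] d_maps[of "k - 1"]
  by (auto simp: boundaries_def cycles_def)

text \<open>Discrete boundaries are both boundaries and discrete cycles, so they are orthogonal to
  \<open>q\<close> and to \<open>q - p\<close>, hence to \<open>p\<close>. Orthogonality of the
  error to all discrete cycles, not only to the discrete harmonics, is kept for the later
  comparison.\<close>

lemma ex_projection_harmonic_to_discrete:
  assumes q: "q \<in> harmonics V d k"
  shows "\<exists>p\<in>harmonics V\<^sub>h d k. q - p \<in> (cycles V\<^sub>h d k)\<^sup>\<bottom>"
proof -
  obtain B where "finite B" "span B = V\<^sub>h k"
    using finite_dimensional by blast
  then obtain p where p: "p \<in> cycles V\<^sub>h d k" "q - p \<in> (cycles V\<^sub>h d k)\<^sup>\<bottom>"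
    using ex_orthogonal_projection_finite_dimensional
        [OF subspace_cycles_V\<^sub>h]
    by (metis (no_types, lifting) cycles_def mem_Collect_eq subsetI)
  have "p \<bullet> b = 0" if b: "b \<in> boundaries V\<^sub>h d k" for b
  proof -
    have "q \<bullet> b = 0"
      using q b boundaries\<^sub>h_subset by (auto simp: harmonics_def mem_orthogonal_comp_iff)
    moreover have "(q - p) \<bullet> b = 0"
      using p b boundaries\<^sub>h_subset_cycles\<^sub>h by (auto simp: mem_orthogonal_comp_iff)
    ultimately show ?thesis
      by (simp add: inner_diff_left)
  qed
  then have "p \<in> harmonics V\<^sub>h d k"
    using p by (simp add: harmonics_def mem_orthogonal_comp_iff)
  with p show ?thesis
    by blast
qed

lemma harmonics\<^sub>h_subset_cycles: "harmonics V\<^sub>h d k \<subseteq> cycles V d k"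
  using cycles\<^sub>h_subset by (auto simp: harmonics_def)

end

section \<open>Error estimates from the cochain projection\<close>

context bounded_cochain_projection
begin

lemma \<pi>_cycle: "q \<in> cycles V d k \<Longrightarrow> \<pi>\<^sub>h k q \<in> cycles V\<^sub>h d k"
  using bounded_linear_\<pi>[of k] cochain[of q k]
    bounded_linear_from_to_0[OF bounded_linear_\<pi> subspace_V]
  by (auto simp: cycles_def bounded_linear_from_to_def)

text \<open>Commutation moves the projection from the boundary to its potential, one degree
  lower.\<close>

lemma \<pi>_boundary:
  assumes "b \<in> boundaries V d k"
  shows "\<pi>\<^sub>h k b \<in> boundaries V\<^sub>h d k"
proof -
  obtain u where u: "u \<in> V (k - 1)" "b = d (k - 1) u"
    using assms by (auto simp: boundaries_def)
  then have "\<pi>\<^sub>h k b = d (k - 1) (\<pi>\<^sub>h (k - 1) u)"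
    using cochain[of u "k - 1"] by simp
  moreover have "\<pi>\<^sub>h (k - 1) u \<in> V\<^sub>h (k - 1)"
    using u bounded_linear_\<pi>[of "k - 1"] by (auto simp: bounded_linear_from_to_def)
  ultimately show ?thesis
    by (simp add: boundaries_def)
qed

text \<open>The competitor \<open>\<pi>\<^sub>h k q\<close> is a discrete cycle but in general not a
  discrete harmonic. Best approximation is therefore applied in the discrete cycles, where
  \<open>q\<close> has the same projection.\<close>

lemma harmonic_discrete_projection:
  assumes q: "q \<in> harmonics V d k"
  defines "p \<equiv> orthogonal_projection (harmonics V\<^sub>h d k) q"
  shows "p \<in> harmonics V\<^sub>h d k" "norm (q - p) \<le> norm (q - \<pi>\<^sub>h k q)"
proof -
  obtain p' where p': "p' \<in> harmonics V\<^sub>h d k" "q - p' \<in> (cycles V\<^sub>h d k)\<^sup>\<bottom>"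
    using ex_projection_harmonic_to_discrete[OF q] by blast
  then have "q - p' \<in> (harmonics V\<^sub>h d k)\<^sup>\<bottom>"
    by (auto simp: harmonics_def mem_orthogonal_comp_iff)
  then have "p = p'"
    using p' unfolding p_def
    by (intro orthogonal_projection_eqI subspace_harmonics_V\<^sub>h)
  moreover have "norm (q - p') \<le> norm (q - \<pi>\<^sub>h k q)"
    using p' \<pi>_cycle[of q k] q
    by (intro norm_diff_le_of_orthogonal
        [OF subspace_cycles_V\<^sub>h])
      (auto simp: harmonics_def)
  ultimately show "p \<in> harmonics V\<^sub>h d k" "norm (q - p) \<le> norm (q - \<pi>\<^sub>h k q)"
    using p' by simp_all
qed

lemma discrete_harmonic_projection_bound:
  assumes q: "q \<in> harmonics V\<^sub>h d k"
  defines "p \<equiv> orthogonal_projection (harmonics V d k) q"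
  shows "norm (q - p) \<le> norm (p - \<pi>\<^sub>h k p)"
proof -
  have cyc: "q \<in> cycles V d k"
    using q harmonics\<^sub>h_subset_cycles by blast
  have p: "p \<in> harmonics V d k"
    unfolding p_def by (rule cycle_harmonic_projection[OF cyc])
  define b where "b = q - p"
  have b: "b \<in> boundaries V d k"
    unfolding b_def p_def by (rule cycle_harmonic_projection[OF cyc])
  have qh: "q \<in> V\<^sub>h k"
    using q by (simp add: harmonics_def cycles_def)
  \<comment> \<open>Linearity on \<open>V k\<close>, together with the fact that the projection
    fixes \<open>q\<close>.\<close>
  have "\<pi>\<^sub>h k b = q - \<pi>\<^sub>h k p"
    using bounded_linear_from_to_diff[OF bounded_linear_\<pi> subspace_V] qh subset_V p
      harmonics_subset projection unfolding b_def by fastforce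
  then have diff: "b - \<pi>\<^sub>h k b = - (p - \<pi>\<^sub>h k p)"
    by (simp add: b_def)
  have "q \<bullet> \<pi>\<^sub>h k b = 0"
    using q \<pi>_boundary[OF b] by (simp add: harmonics_def mem_orthogonal_comp_iff)
  moreover have "p \<bullet> \<pi>\<^sub>h k b = 0"
    using p \<pi>_boundary[OF b] boundaries\<^sub>h_subset
    by (auto simp: harmonics_def mem_orthogonal_comp_iff)
  ultimately have "b \<bullet> \<pi>\<^sub>h k b = 0"
    by (simp add: b_def inner_diff_left)
  then have "norm b * norm b = b \<bullet> (b - \<pi>\<^sub>h k b)"
    by (simp add: inner_diff_right power2_norm_eq_inner flip: power2_eq_square)
  also have "\<dots> \<le> norm b * norm (b - \<pi>\<^sub>h k b)"
    by (rule norm_cauchy_schwarz)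
  finally have "norm b \<le> norm (b - \<pi>\<^sub>h k b)"
    by (cases "b = 0") simp_all
  then show ?thesis
    unfolding diff norm_minus_cancel by (simp add: b_def)
qed

text \<open>A real \<open>Sup\<close> bounds its elements only when the set is bounded above;
  boundedness of the projection supplies this.\<close>

lemma bdd_above_projection_error:
  "bdd_above {norm (q - \<pi>\<^sub>h k q) | q. q \<in> harmonics V d k \<and> norm q = 1}"
proof -
  obtain K where K: "\<And>x. x \<in> V k \<Longrightarrow> norm (\<pi>\<^sub>h k x) \<le> K * norm x"
    using bounded_linear_\<pi>[of k] unfolding bounded_linear_from_to_def by blast
  have "norm (q - \<pi>\<^sub>h k q) \<le> 1 + K" if "q \<in> harmonics V d k" "norm q = 1" for q
    using K[of q] that harmonics_subset norm_triangle_ineq4[of q "\<pi>\<^sub>h k q"] by fastforce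
  then show ?thesis
    by (auto intro!: bdd_aboveI[where M = "1 + K"])
qed

text \<open>Homogeneity: normalize \<open>p\<close> and compare with the supremum over unit vectors.
  The zero vector cannot be normalized, but there the error is zero.\<close>

lemma projection_error_le:
  assumes p: "p \<in> harmonics V d k"
  shows "norm (p - \<pi>\<^sub>h k p)
    \<le> Sup_or_zero {norm (q - \<pi>\<^sub>h k q) | q. q \<in> harmonics V d k \<and> norm q = 1} * norm p"
    (is "_ \<le> Sup_or_zero ?A * _")
proof (cases "p = 0")
  case True
  then show ?thesis
    using bounded_linear_from_to_0[OF bounded_linear_\<pi> subspace_V] by simp
next
  case False
  define u where "u = (1 / norm p) *\<^sub>R p"
  have u: "u \<in> harmonics V d k" "norm u = 1"
    using p False subspace_scale[OF subspace_harmonics_V]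
    by (simp_all add: u_def)
  then have "norm (u - \<pi>\<^sub>h k u) \<in> ?A"
    by blast
  then have "norm (u - \<pi>\<^sub>h k u) \<le> Sup_or_zero ?A"
    using cSup_upper[OF _ bdd_above_projection_error[of k]] by (auto simp: Sup_or_zero_def)
  moreover have "\<pi>\<^sub>h k u = (1 / norm p) *\<^sub>R \<pi>\<^sub>h k p"
    using bounded_linear_\<pi>[of k] p harmonics_subset
    unfolding u_def bounded_linear_from_to_def by blast
  then have "norm (u - \<pi>\<^sub>h k u) = norm (p - \<pi>\<^sub>h k p) / norm p"
    by (simp add: u_def flip: scaleR_diff_right)
  ultimately show ?thesis
    using False by (simp add: divide_le_eq)
qed

text \<open>A unit harmonic form, if there is one, has a nonnegative error below the supremum;
  otherwise the default value zero is taken.\<close>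

lemma Sup_projection_error_nonneg:
  "0 \<le> Sup_or_zero {norm (q - \<pi>\<^sub>h k q) | q. q \<in> harmonics V d k \<and> norm q = 1}"
    (is "0 \<le> Sup_or_zero ?A")
proof (cases "?A = {}")
  case False
  then obtain q where "q \<in> harmonics V d k" "norm q = 1"
    by blast
  then show ?thesis
    using order_trans[OF norm_ge_zero projection_error_le] by fastforce
qed (simp add: Sup_or_zero_def)

end

text \<open>Nonnegativity of \<open>M\<close> covers the empty set with its default value.\<close>

lemma Sup_or_zero_least:
  assumes "0 \<le> M" "\<And>x. x \<in> A \<Longrightarrow> x \<le> M"
  shows "Sup_or_zero A \<le> M"
  using assms by (auto simp: Sup_or_zero_def intro: cSup_least)

theorem theorem3p5:
  fixes V V\<^sub>h :: "int \<Rightarrow> 'a::real_inner set"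
    and d \<pi>\<^sub>h :: "int \<Rightarrow> 'a \<Rightarrow> 'a"
    and k :: int
  assumes "bounded_closed_hilbert_complex V d"
    and "hilbert_subcomplex V d V\<^sub>h"
    and "bounded_cochain_projection V d V\<^sub>h \<pi>\<^sub>h"
  shows "(\<forall>q\<in>harmonics V d k.
            norm (q - orthogonal_projection (harmonics V\<^sub>h d k) q) \<le> norm (q - \<pi>\<^sub>h k q)) \<and>
         (\<forall>q\<in>harmonics V\<^sub>h d k.
            norm (q - orthogonal_projection (harmonics V d k) q) \<le>
            norm (orthogonal_projection (harmonics V d k) q -
                  \<pi>\<^sub>h k (orthogonal_projection (harmonics V d k) q))) \<and>
         gap (harmonics V d k) (harmonics V\<^sub>h d k) \<le>
           Sup_or_zero {norm (q - \<pi>\<^sub>h k q) | q. q \<in> harmonics V d k \<and> norm q = 1}"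
proof -
  interpret bounded_cochain_projection V d V\<^sub>h \<pi>\<^sub>h
    by fact
  let ?H = "harmonics V d k" and ?H\<^sub>h = "harmonics V\<^sub>h d k"
  let ?M = "Sup_or_zero {norm (q - \<pi>\<^sub>h k q) | q. q \<in> ?H \<and> norm q = 1}"
  \<comment> \<open>Zero bounds the norms below, so the infimum is a genuine one. The map
    \<open>f\<close> is left general because the two halves of \<open>gap\<close> vary different
    arguments of the difference.\<close>
  have inf_le: "(INF v\<in>F. norm (f v)) \<le> norm (f w)" if "w \<in> F"
    for F :: "'a set" and f :: "'a \<Rightarrow> 'a" and w
    by (rule cINF_lower[OF _ that]) (rule bdd_belowI2[where m = 0], simp)
  have "(INF v\<in>?H\<^sub>h. norm (u - v)) \<le> ?M" if u: "u \<in> ?H" "norm u = 1" for u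
    using inf_le[OF harmonic_discrete_projection(1)[OF u(1)], of "\<lambda>v. u - v"]
      harmonic_discrete_projection(2)[OF u(1)] projection_error_le[OF u(1)] u(2) by simp
  moreover have "(INF u\<in>?H. norm (u - v)) \<le> ?M" if v: "v \<in> ?H\<^sub>h" "norm v = 1" for v
  proof -
    define p where "p = orthogonal_projection ?H v"
    have cyc: "v \<in> cycles V d k"
      using v harmonics\<^sub>h_subset_cycles by blast
    have p: "p \<in> ?H" "v - p \<in> ?H\<^sup>\<bottom>"
      unfolding p_def by (rule cycle_harmonic_projection[OF cyc])+
    \<comment> \<open>Projection does not increase the norm. With \<open>?M\<close> nonnegative,
      this removes the factor \<open>norm p\<close> from the homogeneous estimate for the possibly
      non-unit vector \<open>p\<close>.\<close>
    have "norm p \<le> 1"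
      using norm_le_of_orthogonal[OF p] v
      by simp
    have "(INF u\<in>?H. norm (u - v)) \<le> norm (v - p)"
      using inf_le[OF p(1), of "\<lambda>u. u - v"] by (simp add: norm_minus_commute)
    also have "\<dots> \<le> norm (p - \<pi>\<^sub>h k p)"
      using discrete_harmonic_projection_bound[OF v(1)] by (simp add: p_def)
    also have "\<dots> \<le> ?M * norm p"
      by (rule projection_error_le[OF p(1)])
    also have "\<dots> \<le> ?M"
      using Sup_projection_error_nonneg \<open>norm p \<le> 1\<close> by (rule mult_left_le[rotated])
    finally show ?thesis .
  qed
  ultimately have "gap ?H ?H\<^sub>h \<le> ?M"
    unfolding gap_def using Sup_projection_error_nonneg
    by (intro max.boundedI Sup_or_zero_least) auto
  then show ?thesis
    using harmonic_discrete_projection(2) discrete_harmonic_projection_bound by blast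
qed

end
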